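(* Let $\mathbf{L}=\langle L,\leq\rangle$ be a complete lattice and $S$ an $L$-parameterization. A system $\mathcal{S}\subseteq L$ is an $S$-closure system in $\mathbf{L}$ if and only if for every $a\in L$, $$\bigwedge\{h(b);\ a\leq h(b),\ b\in\mathcal{S},\ \langle f,h\rangle\in S\}\in\mathcal{S}.$$
   Context: An isotone Galois connection in $\mathbf{L}$ is a pair $\langle f,h\rangle$ of maps $L\to L$ with $f(a)\leq b$ iff $a\leq h(b)$. An $L$-parameterization is a set $S$ of isotone Galois connections containing $\langle\mathrm{id},\mathrm{id}\rangle$. A closure system in $\mathbf{L}$ is a subset of $L$ closed under arbitrary infima (including the empty infimum $1$). An $S$-closure system is a closure system $\mathcal{S}$ in $\mathbf{L}$ such that $h(a)\in\mathcal{S}$ for all $\langle f,h\rangle\in S$ and all $a\in\mathcal{S}$. *)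

theory Defs
  imports Main
begin

definition isotone_galois_connection :: "('a::complete_lattice \<Rightarrow> 'a) \<times> ('a \<Rightarrow> 'a) \<Rightarrow> bool" where
  "isotone_galois_connection = (\<lambda>(f, h). \<forall>a b. f a \<le> b \<longleftrightarrow> a \<le> h b)"

definition L_parameterization :: "(('a::complete_lattice \<Rightarrow> 'a) \<times> ('a \<Rightarrow> 'a)) set \<Rightarrow> bool" where
  "L_parameterization S \<longleftrightarrow> (\<forall>p\<in>S. isotone_galois_connection p) \<and> (id, id) \<in> S"

text \<open>The case \<open>A = {}\<close> is included, so every closure system contains \<open>top\<close>.\<close>

definition closure_system :: "'a::complete_lattice set \<Rightarrow> bool" where
  "closure_system C \<longleftrightarrow> (\<forall>A. A \<subseteq> C \<longrightarrow> Inf A \<in> C)"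

definition S_closure_system ::
  "(('a::complete_lattice \<Rightarrow> 'a) \<times> ('a \<Rightarrow> 'a)) set \<Rightarrow> 'a set \<Rightarrow> bool" where
  "S_closure_system S C \<longleftrightarrow> closure_system C \<and> (\<forall>(f, h)\<in>S. \<forall>a\<in>C. h a \<in> C)"

end

theory Submission imports Defs begin

text \<open>Let M(a) be the set of all h(b) >= a with b in \<open>C\<close> and (f, h) in
  \<open>S\<close>. If \<open>C\<close> is an \<open>S\<close>-closure system, M(a) lies in
  \<open>C\<close>, hence so does its infimum. Conversely, a is always a lower bound of M(a), so the
  infimum of M(a) is a itself as soon as M(a) contains a or a set with infimum a; then the condition
  puts a into \<open>C\<close>. This is applied to a = \<open>Inf A\<close> and to a =
  \<open>h b\<close>.\<close>

theorem theorem41: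
  fixes S :: "(('a::complete_lattice \<Rightarrow> 'a) \<times> ('a \<Rightarrow> 'a)) set"
    and C :: "'a set"
  assumes "L_parameterization S"
  shows "S_closure_system S C \<longleftrightarrow>
    (\<forall>a. Inf {h b | f h b. a \<le> h b \<and> b \<in> C \<and> (f, h) \<in> S} \<in> C)"
proof
  assume C: "S_closure_system S C"
  then have "{h b | f h b. a \<le> h b \<and> b \<in> C \<and> (f, h) \<in> S} \<subseteq> C" for a
    by (auto simp: S_closure_system_def)
  then show "\<forall>a. Inf {h b | f h b. a \<le> h b \<and> b \<in> C \<and> (f, h) \<in> S} \<in> C"
    using C by (simp add: S_closure_system_def closure_system_def)
next
  let ?above = "\<lambda>a. {h b | f h b. a \<le> h b \<and> b \<in> C \<and> (f, h) \<in> S}"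
  assume Inf_above: "\<forall>a. Inf (?above a) \<in> C"
  have id_S: "(id, id) \<in> S"
    using assms by (simp add: L_parameterization_def)
  have above_lower: "a \<le> Inf (?above a)" for a
    by (rule Inf_greatest) auto
  have "Inf A \<in> C" if "A \<subseteq> C" for A
  proof -
    have "A \<subseteq> ?above (Inf A)"
    proof
      fix x assume "x \<in> A"
      \<comment> \<open>The identity pair exhibits each element of \<open>C\<close> as a value h(b),
        so the members of \<open>A\<close> qualify.\<close>
      then have "Inf A \<le> id x \<and> x \<in> C \<and> (id, id) \<in> S"
        using that id_S by (auto intro: Inf_lower)
      then have "id x \<in> ?above (Inf A)" by blast
      then show "x \<in> ?above (Inf A)" by simp
    qed
    \<comment> \<open>A larger set has a smaller infimum; \<open>above_lower\<close> gives the other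
      inequality. Empty \<open>A\<close> is covered too.\<close>
    then have "Inf (?above (Inf A)) = Inf A"
      by (intro antisym Inf_superset_mono above_lower)
    then show ?thesis using Inf_above[rule_format, of "Inf A"] by (simp only:)
  qed
  moreover have "h b \<in> C" if "(f, h) \<in> S" "b \<in> C" for f h b
  proof -
    \<comment> \<open>With \<open>h b\<close> as its own bound, the infimum is attained.\<close>
    have "h b \<in> ?above (h b)" using that by blast
    then have "Inf (?above (h b)) = h b"
      by (intro antisym Inf_lower above_lower)
    then show ?thesis using Inf_above[rule_format, of "h b"] by (simp only:)
  qed
  ultimately show "S_closure_system S C"
    by (auto simp: S_closure_system_def closure_system_def)
qed

end
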